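(* Let $G\subseteq GL_n(\mathbb{C})$ be a finite matrix group. Then $\bigcup_{k \in \mathcal{K}} \Pi_k \subseteq \mathrm{HS}(G)$, in which $\mathcal{K}$ is the set of all positive integers $k$ such that some element $A \in G$ has a primitive $k$th root of unity as an eigenvalue. In particular, $\Pi_p \subseteq \mathrm{HS}(G)$ whenever $p$ is a prime that divides the order of $G$.
   Context: For a set $S \subseteq M_n(\mathbb{C})$, $\mathrm{Co}(S)$ denotes the set of all (finite) convex combinations of elements of $S$, and the hull spectrum $\mathrm{HS}(S)\subseteq\mathbb{C}$ is the set of all complex numbers that occur as eigenvalues of some matrix in $\mathrm{Co}(S)$. $\Pi_k$ denotes the convex hull in $\mathbb{C}$ of the $k$th roots of unity. *)

theory Defs
  imports "HOL-Analysis.Analysis" "HOL-Algebra.Group" "HOL-Computational_Algebra.Primes"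
begin

definition GL :: "(complex^'n^'n) monoid" where
  "GL = \<lparr>carrier = {A. invertible A}, mult = (**), one = mat 1\<rparr>"

lemma group_GL: "group (GL :: (complex^'n^'n) monoid)"
proof (rule groupI)
  fix A :: "complex^'n^'n"
  assume "A \<in> carrier GL"
  then obtain B where "A ** B = mat 1" "B ** A = mat 1"
    by (auto simp: GL_def invertible_def)
  then show "\<exists>B\<in>carrier GL. B \<otimes>\<^bsub>GL\<^esub> A = \<one>\<^bsub>GL\<^esub>"
    by (intro bexI[of _ B]) (auto simp: GL_def invertible_def)
next
  show "\<one>\<^bsub>GL\<^esub> \<in> carrier (GL :: (complex^'n^'n) monoid)"
    by (auto simp: GL_def invertible_def intro: exI[of _ "mat 1"])
qed (auto simp: GL_def invertible_mult matrix_mul_assoc)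

definition eigenvalue :: "complex^'n^'n \<Rightarrow> complex \<Rightarrow> bool" where
  "eigenvalue A z \<longleftrightarrow> (\<exists>v. v \<noteq> 0 \<and> A *v v = z *s v)"

(* Co(S) is the library's convex hull in the real vector space of complex matrices;
   by convex_hull_explicit it is the set of finite convex combinations of elements of S. *)
definition HS :: "(complex^'n^'n) set \<Rightarrow> complex set" where
  "HS S = {z. \<exists>A \<in> convex hull S. eigenvalue A z}"

definition root_polygon :: "nat \<Rightarrow> complex set" where
  "root_polygon k = convex hull {z. z ^ k = 1}"

definition primitive_root_of_unity :: "nat \<Rightarrow> complex \<Rightarrow> bool" where
  "primitive_root_of_unity k z \<longleftrightarrow> k > 0 \<and> z ^ k = 1 \<and> (\<forall>j. 0 < j \<and> j < k \<longrightarrow> z ^ j \<noteq> 1)"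

definition eigenvalue_orders :: "(complex^'n^'n) set \<Rightarrow> nat set" where
  "eigenvalue_orders G =
     {k. k > 0 \<and> (\<exists>A\<in>G. \<exists>z. primitive_root_of_unity k z \<and> eigenvalue A z)}"

end

theory Submission
  imports Defs "HOL-Algebra.Sylow" "HOL-Algebra.Multiplicative_Group"
begin

text \<open>If \<open>v\<close> is an eigenvector of \<open>A \<in> G\<close> for a primitive \<open>k\<close>th root of unity \<open>z\<close>, then it is an
  eigenvector of \<open>A ^ j \<in> G\<close> for \<open>z ^ j\<close>. The eigenvalues for the fixed vector \<open>v\<close> of matrices in
  \<open>Co(G)\<close> form a convex set, which therefore contains the hull of all \<open>k\<close>th roots of unity. For
  a prime \<open>p\<close> dividing the order of \<open>G\<close>, Cauchy's theorem gives an element of order \<open>p\<close>, and it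
  has an eigenvalue other than 1.\<close>

lemma primitive_root_of_unity_exists:
  assumes "k > 0"
  shows "\<exists>z. primitive_root_of_unity k z"
proof (intro exI)
  \<comment> \<open>The \<open>j\<close>th power of this number is 1 only if \<open>k\<close>
    divides \<open>j\<close>, which \<open>0 < j < k\<close> excludes.\<close>
  show "primitive_root_of_unity k (exp (2 * of_real pi * \<i> * of_nat 1 / of_nat k))"
    using assms complex_root_unity [of k 1] complex_root_unity_eq_1 [of k]
    by (auto simp: primitive_root_of_unity_def simp flip: exp_of_nat_mult
        simp: algebra_simps dest: dvd_imp_le)
qed

text \<open>Each \<open>j\<close> strictly between 0 and the prime \<open>p\<close> is invertible
  modulo \<open>p\<close>, so \<open>z\<close> is a power of \<open>z ^ j\<close>, and
  \<open>z ^ j = 1\<close> would force \<open>z = 1\<close>.\<close>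

lemma primitive_root_of_unity_prime:
  assumes "prime p" "z ^ p = 1" "z \<noteq> 1"
  shows "primitive_root_of_unity p z"
  unfolding primitive_root_of_unity_def
proof (intro conjI allI impI)
  show "p > 0" using assms(1) by (simp add: prime_gt_0_nat)
  fix j assume j: "0 < j \<and> j < p"
  then have "coprime j p"
    using assms(1) by (metis coprime_commute nat_dvd_not_less prime_imp_coprime_nat)
  with j obtain a b where ab: "j * a = p * b + 1"
    using bezout_nat[of j p] by (metis coprime_imp_gcd_eq_1 neq0_conv)
  show "z ^ j \<noteq> 1"
  proof
    assume "z ^ j = 1"
    then have "z ^ (j * a) = 1" by (simp add: power_mult)
    moreover have "z ^ (j * a) = z"
      by (simp add: ab power_mult assms(2))
    ultimately show False using assms(3) by simp
  qed
qed (rule assms)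

text \<open>Primitivity makes these powers pairwise distinct, and there are exactly \<open>k\<close>
  roots of unity, so counting turns the inclusion into equality.\<close>

lemma roots_unity_eq_powers:
  assumes "primitive_root_of_unity k z"
  shows "{w. w ^ k = 1} = (\<lambda>j. z ^ j) ` {..<k}"
proof -
  from assms have k: "k > 0" and zk: "z ^ k = 1"
    and prim: "\<And>j. 0 < j \<Longrightarrow> j < k \<Longrightarrow> z ^ j \<noteq> 1"
    by (auto simp: primitive_root_of_unity_def)
  from k zk have z0: "z \<noteq> 0" by (auto simp: power_0_left)
  have "inj_on (\<lambda>j. z ^ j) {..<k}"
  proof (rule linorder_inj_onI)
    fix i j assume ij: "i < j" "i \<in> {..<k}" "j \<in> {..<k}"
    have "z ^ j = z ^ i * z ^ (j - i)" using ij by (simp flip: power_add)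
    then show "z ^ i \<noteq> z ^ j" using prim[of "j - i"] ij z0 by auto
  qed auto
  then have "card ((\<lambda>j. z ^ j) ` {..<k}) = card {w::complex. w ^ k = 1}"
    using k by (simp add: card_image card_roots_unity_eq)
  moreover have "(\<lambda>j. z ^ j) ` {..<k} \<subseteq> {w. w ^ k = 1}"
    by (auto simp: zk power_mult[symmetric] mult.commute[of _ k]) (simp add: zk power_mult)
  ultimately show ?thesis
    using k by (metis card_subset_eq finite_roots_unity le_simps(3) One_nat_def)
qed

lemma pow_GL_mult_eigenvector:
  fixes A :: "complex^'n^'n"
  assumes "A *v v = z *s v"
  shows "(A [^]\<^bsub>GL\<^esub> (j::nat)) *v v = z ^ j *s v"
proof (induction j)
  case 0
  show ?case by (simp add: nat_pow_def GL_def)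
next
  case (Suc j)
  have "(A [^]\<^bsub>GL\<^esub> Suc j) *v v = (A [^]\<^bsub>GL\<^esub> j) *v (A *v v)"
    by (simp add: nat_pow_def GL_def matrix_vector_mul_assoc)
  then show ?case using Suc by (simp add: assms vector_scalar_commute)
qed

text \<open>With \<open>v\<close> fixed, \<open>M *v v\<close> is linear in \<open>M\<close>, so a
  convex combination of matrices acts on \<open>v\<close> by the same combination of the
  scalars.\<close>

lemma convex_eigenvalues_fixed_eigenvector:
  fixes v :: "complex^'n"
  assumes "convex S"
  shows "convex {z. \<exists>M\<in>S. M *v v = z *s v}"
proof (rule convexI)
  fix x y and s t :: real
  assume st: "0 \<le> s" "0 \<le> t" "s + t = 1"
    and "x \<in> {z. \<exists>M\<in>S. M *v v = z *s v}" "y \<in> {z. \<exists>M\<in>S. M *v v = z *s v}"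
  then obtain M N where MN: "M \<in> S" "M *v v = x *s v" "N \<in> S" "N *v v = y *s v"
    by auto
  have "s *\<^sub>R M + t *\<^sub>R N \<in> S" using assms MN st by (simp add: convexD)
  moreover have "(s *\<^sub>R M + t *\<^sub>R N) *v v = (s *\<^sub>R x + t *\<^sub>R y) *s v"
  proof -
    have "(r *\<^sub>R K) *v v = r *\<^sub>R (K *v v)" for r and K :: "complex^'n^'n"
      by (simp add: vec_eq_iff matrix_vector_mult_def scaleR_sum_right)
    then show ?thesis
      using MN by (simp add: matrix_vector_mult_add_rdistrib vector_sadd_rdistrib vec_eq_iff)
  qed
  ultimately show "s *\<^sub>R x + t *\<^sub>R y \<in> {z. \<exists>M\<in>S. M *v v = z *s v}" by blast
qed

lemma root_polygon_subset_HS: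
  fixes G :: "(complex^'n^'n) set"
  assumes G: "subgroup G GL" and k: "k \<in> eigenvalue_orders G"
  shows "root_polygon k \<subseteq> HS G"
proof -
  from k obtain A z v where A: "A \<in> G" "primitive_root_of_unity k z" "v \<noteq> 0" "A *v v = z *s v"
    by (auto simp: eigenvalue_orders_def eigenvalue_def)
  interpret GL: group "GL :: (complex^'n^'n) monoid" by (rule group_GL)
  let ?E = "{z. \<exists>M\<in>convex hull G. M *v v = z *s v}"
  have "A [^]\<^bsub>GL\<^esub> j \<in> G" for j :: nat
    using GL.subgroup_int_pow_closed[OF G A(1), of "int j"] by (simp add: int_pow_int)
  then have "z ^ j \<in> ?E" for j
    using pow_GL_mult_eigenvector[OF A(4), of j] by (auto intro: hull_inc)
  then have "root_polygon k \<subseteq> ?E"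
    unfolding root_polygon_def roots_unity_eq_powers[OF A(2)]
    by (intro hull_minimal convex_eigenvalues_fixed_eigenvector) auto
  also have "?E \<subseteq> HS G" using A(3) by (auto simp: HS_def eigenvalue_def)
  finally show ?thesis .
qed

text \<open>Sylow's theorem with exponent 1 gives a subgroup of order \<open>p\<close>, where the
  cofactor \<open>m\<close> may still be divisible by \<open>p\<close>. By Lagrange all its elements
  have trivial \<open>p\<close>th power, and \<open>p > 1\<close> leaves one other than the
  unit.\<close>

lemma (in group) cauchy_prime_order:
  assumes "finite (carrier G)" "prime p" "p dvd order G"
  shows "\<exists>x\<in>carrier G. x \<noteq> \<one> \<and> x [^] p = \<one>"
proof -
  obtain m where "order G = p ^ 1 * m" using assms(3) by (auto simp: dvd_def)
  from sylow_thm[OF assms(2) is_group this assms(1)]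
  obtain H where H: "subgroup H G" "card H = p" by auto
  have "\<not> H \<subseteq> {\<one>}"
    using H(2) assms(2) card_mono[of "{\<one>}" H] prime_gt_1_nat[of p] by auto
  then obtain x where x: "x \<in> H" "x \<noteq> \<one>" by auto
  interpret H: group "G\<lparr>carrier := H\<rparr>" using H(1) by (rule subgroup_imp_group)
  have "x [^]\<^bsub>G\<lparr>carrier := H\<rparr>\<^esub> order (G\<lparr>carrier := H\<rparr>) = \<one>\<^bsub>G\<lparr>carrier := H\<rparr>\<^esub>"
    by (rule H.pow_order_eq_1) (use x in auto)
  then have "x [^] p = \<one>"
    using H by (simp add: order_def nat_pow_consistent[symmetric])
  then show ?thesis using x H(1) subgroup.mem_carrier by metis
qed

text \<open>Discrete Fourier transform of the orbit of a vector moved by \<open>A\<close>: the component for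
  \<open>\<zeta> ^ j\<close> is an eigenvector for \<open>inverse (\<zeta> ^ j)\<close> unless it vanishes. The components sum to
  a nonzero multiple of the vector, so they cannot vanish for all \<open>j \<noteq> 0\<close>.\<close>
lemma eigenvalue_of_finite_order:
  fixes A :: "complex^'n^'n"
  assumes p: "p > 0" and Ap: "A [^]\<^bsub>GL\<^esub> p = \<one>\<^bsub>GL\<^esub>" and A1: "A \<noteq> \<one>\<^bsub>GL\<^esub>"
  shows "\<exists>z. z \<noteq> 1 \<and> z ^ p = 1 \<and> eigenvalue A z"
proof -
  define a where "a i = A [^]\<^bsub>GL\<^esub> (i::nat)" for i
  have a_0: "a 0 = mat 1" and a_Suc': "a (Suc i) = a i ** A" for i
    by (simp_all add: a_def nat_pow_def GL_def)
  \<comment> \<open>\<open>[^]\<close> multiplies on the right, whereas \<open>A\<close> acts on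
    \<open>f j\<close> from the left.\<close>
  have a_Suc: "A ** a i = a (Suc i)" for i
    by (induction i) (simp_all add: a_0 a_Suc' matrix_mul_assoc)
  have a_p: "a p = mat 1" using Ap by (simp add: a_def GL_def)
  obtain x where x: "A *v x \<noteq> x"
    using A1 by (metis GL_def matrix_eq matrix_vector_mul_lid monoid.select_convs(2))
  obtain \<zeta> where \<zeta>: "primitive_root_of_unity p \<zeta>"
    using primitive_root_of_unity_exists[OF p] by blast
  then have \<zeta>p: "\<zeta> ^ p = 1" and \<zeta>i: "\<And>i. 0 < i \<Longrightarrow> i < p \<Longrightarrow> \<zeta> ^ i \<noteq> 1"
    by (auto simp: primitive_root_of_unity_def)
  define f where "f j = (\<Sum>i<p. (\<zeta> ^ j) ^ i *s (a i *v x))" for j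
  have root: "(\<zeta> ^ j) ^ p = 1" for j
    by (metis \<zeta>p power_mult mult.commute power_one)
  \<comment> \<open>Applying \<open>A\<close> and scaling by \<open>\<zeta> ^ j\<close> moves each
    summand to the next index. The sum is cyclic: \<open>g p = g 0\<close>, since
    \<open>(\<zeta> ^ j) ^ p = 1\<close> and \<open>a p = mat 1\<close>.\<close>
  have shift: "\<zeta> ^ j *s (A *v f j) = f j" for j
  proof -
    define g where "g i = (\<zeta> ^ j) ^ i *s (a i *v x)" for i
    have "\<zeta> ^ j *s (A *v f j) = (\<Sum>i<p. g (Suc i))"
      by (simp add: f_def g_def vec.linear_sum[OF matrix_vector_mul_linear_gen]
          vector_scalar_commute vec.scale_sum_right matrix_vector_mul_assoc a_Suc)
    also have "\<dots> = (\<Sum>i<p. g i) + g p - g 0"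
      using sum.lessThan_Suc[of g p] sum.lessThan_Suc_shift[of g p] by (simp add: algebra_simps)
    also have "\<dots> = f j" by (simp add: f_def g_def root a_p a_0)
    finally show ?thesis .
  qed
  \<comment> \<open>Orthogonality of characters: for \<open>0 < i < p\<close> this is a geometric
    sum whose ratio \<open>\<zeta> ^ i\<close> differs from 1 but has \<open>p\<close>th power
    1.\<close>
  have geom: "(\<Sum>j<p. (\<zeta> ^ j) ^ i) = (if i = 0 then of_nat p else 0)" if "i < p" for i
  proof (cases "i = 0")
    case False
    have "(\<Sum>j<p. (\<zeta> ^ j) ^ i) = (\<Sum>j<p. (\<zeta> ^ i) ^ j)"
      by (simp add: power_mult[symmetric] mult.commute)
    also have "\<dots> = 0" using \<zeta>i[of i] that False root[of i] by (simp add: geometric_sum)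
    finally show ?thesis using False by simp
  qed simp
  have "(\<Sum>j<p. f j) = (\<Sum>i<p. (\<Sum>j<p. (\<zeta> ^ j) ^ i) *s (a i *v x))"
    unfolding f_def vec.scale_sum_left by (rule sum.swap)
  also have "\<dots> = (\<Sum>i<p. if i = 0 then of_nat p *s x else 0)"
    by (intro sum.cong) (auto simp: geom a_0)
  also have "\<dots> = of_nat p *s x" using p by simp
  finally have total: "(\<Sum>j<p. f j) = of_nat p *s x" .
  \<comment> \<open>Otherwise \<open>f 0\<close> alone would equal \<open>of_nat p *s x\<close>; but
    \<open>A\<close> fixes \<open>f 0\<close>, so it would fix \<open>x\<close>, against the choice
    of \<open>x\<close>.\<close>
  have "\<exists>j<p. j \<noteq> 0 \<and> f j \<noteq> 0"
  proof (rule ccontr)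
    assume "\<not> ?thesis"
    then have "(\<Sum>j<p. f j) = (\<Sum>j<p. if j = 0 then f 0 else 0)"
      by (intro sum.cong) auto
    also have "\<dots> = f 0" using p by simp
    finally have "of_nat p *s x = f 0" using total by simp
    with shift[of 0] have "A *v (of_nat p *s x) = of_nat p *s x" by simp
    then have "of_nat p *s (A *v x) = of_nat p *s x" by (simp add: vector_scalar_commute)
    then show False using x p by (simp add: vec_eq_iff)
  qed
  then obtain j where j: "j < p" "j \<noteq> 0" "f j \<noteq> 0" by blast
  have "\<zeta> \<noteq> 0" using \<zeta>p p by (auto simp: power_0_left)
  then have "A *v f j = inverse (\<zeta> ^ j) *s f j"
    using shift[of j] by (metis left_inverse power_not_zero vector_smult_assoc vector_smult_lid)
  moreover have "inverse (\<zeta> ^ j) \<noteq> 1" using \<zeta>i[of j] j by simp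
  moreover have "inverse (\<zeta> ^ j) ^ p = 1" by (metis root power_inverse inverse_1)
  ultimately show ?thesis using j(3) unfolding eigenvalue_def by blast
qed

lemma prime_dvd_card_in_eigenvalue_orders:
  fixes G :: "(complex^'n^'n) set"
  assumes G: "subgroup G GL" "finite G" and p: "prime p" "p dvd card G"
  shows "p \<in> eigenvalue_orders G"
proof -
  interpret GL: group "GL :: (complex^'n^'n) monoid" by (rule group_GL)
  interpret H: group "GL\<lparr>carrier := G\<rparr>" using G(1) by (rule GL.subgroup_imp_group)
  obtain A where A: "A \<in> G" "A \<noteq> \<one>\<^bsub>GL\<^esub>" "A [^]\<^bsub>GL\<^esub> p = \<one>\<^bsub>GL\<^esub>"
    using H.cauchy_prime_order[of p] G(2) p by (auto simp: order_def GL.nat_pow_consistent[symmetric])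
  obtain z where "z \<noteq> 1" "z ^ p = 1" "eigenvalue A z"
    using eigenvalue_of_finite_order[of p A] A p(1) prime_gt_0_nat by blast
  then show ?thesis
    using primitive_root_of_unity_prime[of p z] p(1) A(1) prime_gt_0_nat
    unfolding eigenvalue_orders_def by blast
qed

theorem lemma4p1:
  fixes G :: "(complex^'n^'n) set"
  assumes "subgroup G GL" and "finite G"
  shows "(\<Union>k\<in>eigenvalue_orders G. root_polygon k) \<subseteq> HS G
       \<and> (\<forall>p::nat. prime p \<and> p dvd card G \<longrightarrow> root_polygon p \<subseteq> HS G)"
  using root_polygon_subset_HS[OF assms(1)] prime_dvd_card_in_eigenvalue_orders[OF assms]
  by blast

end
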